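(* Suppose that every entry of $A$ is $0$ or $1$ and $b=\mathbf{1}$ (the all-ones vector), and that at least one of the following holds: (i) for all $j\in\{1,\dots,p\}$, there exists $x_j\in\mathcal{X}_j$ such that $A_jx_j\le\mathbf{1}$, and $\{s\in\{1,\dots,n_j\}: c_{j_s}\neq0\}\subseteq T_{A_j}$; (ii) for all $j\in\{1,\dots,p\}$, there is at most one nonzero element in the vector $c_j$, and $\{x_j\in\{0,1\}^{n_j}: A_jx_j\le\mathbf{1}\}\subseteq\mathcal{X}_j$. Let $\lambda\in\mathbb{R}^m_+$ and $\rho>0$ be fixed. If the starting point satisfies $x^0\in\mathcal{X}$, then the block coordinate descent method with the classical update is always executable (every block subproblem has an optimal solution) and terminates after a finite number of iterations with a blockwise optimal solution of the problem $\min_{x\in\mathcal{X}}L(x,\lambda,\rho)$.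
   Context: Problem data: $n=\sum_{j=1}^p n_j$, $c=(c_1;\dots;c_p)$ with $c_j\in\mathbb{R}^{n_j}$, $A=(A_1\ \cdots\ A_p)\in\mathbb{R}^{m\times n}$ with $A_j\in\mathbb{R}^{m\times n_j}$, $b\in\mathbb{R}^m$, $x=(x_1;\dots;x_p)$, $\mathcal{X}=\mathcal{X}_1\times\dots\times\mathcal{X}_p$ with $\mathcal{X}_j=\{x_j\in\{0,1\}^{n_j}: B_jx_j\le d_j\}$ for given real $B_j,d_j$. The set $\mathcal{X}$ is nonempty and $\{x\in\mathcal{X}:Ax\le b\}$ is nonempty. $c_{j_s}$ is the $s$-th entry of $c_j$, and $T_{A_j}$ is the set of indices of columns of $A_j$ containing only zeros. The augmented Lagrangian is $L(x,\lambda,\rho)=c^{\top}x+\lambda^{\top}(Ax-b)+\frac{\rho}{2}\|(Ax-b)_+\|^2$, where $(\cdot)_+$ is the componentwise positive part. Block coordinate descent with the classical update, for fixed $\lambda,\rho$: given $x^t=(x_1^t;\dots;x_p^t)$, for $j=1,\dots,p$ in order choose $$x_j^{t+1}\in\arg\min_{x_j\in\mathcal{X}_j}L(x_1^{t+1},\dots,x_{j-1}^{t+1},x_j,x_{j+1}^t,\dots,x_p^t,\lambda,\rho);$$ the method terminates when $x^{t+1}=x^t$. A feasible $x^*\in\mathcal{X}$ is blockwise optimal for $\min_{x\in\mathcal{X}}L(x,\lambda,\rho)$ if for each $j\in\{1,\dots,p\}$ and all $x=(x_1^*,\dots,x_{j-1}^*,x_j,x_{j+1}^*,\dots,x_p^*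 )\in\mathcal{X}$ one has $L(x^*,\lambda,\rho)\le L(x,\lambda,\rho)$.
   Formalization: Finite termination is stated for runs in which a block that already minimizes its subproblem is left unchanged; with arbitrary choices in the argmin it fails (A=0, c=0, X={0,1}: iterates may alternate forever). *)

theory Defs
  imports Complex_Main "Jordan_Normal_Form.Matrix"
begin

text \<open>
  Blocks, rows and entries are counted from \<open>0\<close>: block \<open>j < nblocks P\<close> has dimension
  \<open>bdim P j\<close>. A point \<open>x = (x\<^sub>1; \<dots>; x\<^sub>p)\<close> is the list of its blocks.
\<close>

record block_problem =
  nblocks :: nat
  nrows :: nat
  bdim :: "nat \<Rightarrow> nat"
  cost :: "nat \<Rightarrow> real vec"
  lmat :: "nat \<Rightarrow> real mat"
  rhs :: "real vec"
  brows :: "nat \<Rightarrow> nat"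
  bmat :: "nat \<Rightarrow> real mat"
  bvec :: "nat \<Rightarrow> real vec"

definition binary_vecs :: "nat \<Rightarrow> real vec set" where
  "binary_vecs k = {v \<in> carrier_vec k. \<forall>s<k. v $ s \<in> {0, 1}}"

definition Xblock :: "block_problem \<Rightarrow> nat \<Rightarrow> real vec set" where
  "Xblock P j = {v \<in> binary_vecs (bdim P j). bmat P j *\<^sub>v v \<le> bvec P j}"

definition Xset :: "block_problem \<Rightarrow> real vec list set" where
  "Xset P = {x. length x = nblocks P \<and> (\<forall>j<nblocks P. x ! j \<in> Xblock P j)}"

text \<open>\<open>A x = A\<^sub>1 x\<^sub>1 + \<dots> + A\<^sub>p x\<^sub>p\<close> for \<open>A = (A\<^sub>1 \<dots> A\<^sub>p)\<close>, and likewise \<open>c\<^sup>T x\<close>.\<close>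

definition lhs :: "block_problem \<Rightarrow> real vec list \<Rightarrow> real vec" where
  "lhs P x = vec (nrows P) (\<lambda>i. \<Sum>j<nblocks P. (lmat P j *\<^sub>v x ! j) $ i)"

definition objective :: "block_problem \<Rightarrow> real vec list \<Rightarrow> real" where
  "objective P x = (\<Sum>j<nblocks P. cost P j \<bullet> x ! j)"

definition block_problem_data :: "block_problem \<Rightarrow> bool" where
  "block_problem_data P \<longleftrightarrow>
     rhs P \<in> carrier_vec (nrows P) \<and>
     (\<forall>j<nblocks P.
        cost P j \<in> carrier_vec (bdim P j) \<and>
        lmat P j \<in> carrier_mat (nrows P) (bdim P j) \<and>
        bmat P j \<in> carrier_mat (brows P j) (bdim P j) \<and>
        bvec P j \<in> carrier_vec (brows P j)) \<and>
     Xset P \<noteq> {} \<and>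
     {x \<in> Xset P. lhs P x \<le> rhs P} \<noteq> {}"

definition pos_part_vec :: "real vec \<Rightarrow> real vec" where
  "pos_part_vec v = map_vec (\<lambda>r. max r 0) v"

definition aug_lagrangian :: "block_problem \<Rightarrow> real vec \<Rightarrow> real \<Rightarrow> real vec list \<Rightarrow> real" where
  "aug_lagrangian P lam rho x =
     (let r = lhs P x - rhs P; rp = pos_part_vec r
      in objective P x + lam \<bullet> r + rho / 2 * (rp \<bullet> rp))"

definition zero_cols :: "block_problem \<Rightarrow> nat \<Rightarrow> nat set" where
  "zero_cols P j = {s. s < bdim P j \<and> col (lmat P j) s = 0\<^sub>v (nrows P)}"

definition cost_support :: "block_problem \<Rightarrow> nat \<Rightarrow> nat set" where
  "cost_support P j = {s. s < bdim P j \<and> cost P j $ s \<noteq> 0}"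

text \<open>
  The list \<open>ys\<close> holds the blocks already updated in the current sweep and \<open>x\<close> is the previous
  iterate: the subproblem for block \<open>length ys\<close> minimises over that block, with the earlier
  blocks taken from \<open>ys\<close> and the later ones from \<open>x\<close>.
\<close>

definition block_minimizer ::
    "block_problem \<Rightarrow> real vec \<Rightarrow> real \<Rightarrow> real vec list \<Rightarrow> real vec list \<Rightarrow> real vec \<Rightarrow> bool" where
  "block_minimizer P lam rho x ys v \<longleftrightarrow>
     is_arg_min (\<lambda>w. aug_lagrangian P lam rho (ys @ w # drop (Suc (length ys)) x))
       (\<lambda>w. w \<in> Xblock P (length ys)) v"

definition partial_sweep ::
    "block_problem \<Rightarrow> real vec \<Rightarrow> real \<Rightarrow> real vec list \<Rightarrow> real vec list \<Rightarrow> bool" where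
  "partial_sweep P lam rho x ys \<longleftrightarrow>
     length ys \<le> nblocks P \<and>
     (\<forall>j<length ys. block_minimizer P lam rho x (take j ys) (ys ! j))"

definition bcd_step ::
    "block_problem \<Rightarrow> real vec \<Rightarrow> real \<Rightarrow> real vec list \<Rightarrow> real vec list \<Rightarrow> bool" where
  "bcd_step P lam rho x y \<longleftrightarrow> length y = nblocks P \<and> partial_sweep P lam rho x y"

text \<open>
  If ties in the argmin may be broken arbitrarily, the method need not terminate: for
  \<open>p = m = n\<^sub>1 = 1\<close>, \<open>A = 0\<close>, \<open>c = 0\<close>, \<open>\<X> = {0, 1}\<close> the function \<open>L\<close> is constant on \<open>\<X>\<close> and the
  iterates may alternate between \<open>0\<close> and \<open>1\<close>. Termination is therefore understood under the
  convention below: a block that is already a minimizer of its subproblem is left unchanged.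
  Otherwise the choice of the minimizer stays arbitrary.
\<close>

definition keeps_minimizers ::
    "block_problem \<Rightarrow> real vec \<Rightarrow> real \<Rightarrow> real vec list \<Rightarrow> real vec list \<Rightarrow> bool" where
  "keeps_minimizers P lam rho x y \<longleftrightarrow>
     (\<forall>j<nblocks P. block_minimizer P lam rho x (take j y) (x ! j) \<longrightarrow> y ! j = x ! j)"

definition blockwise_optimal ::
    "block_problem \<Rightarrow> real vec \<Rightarrow> real \<Rightarrow> real vec list \<Rightarrow> bool" where
  "blockwise_optimal P lam rho xs \<longleftrightarrow>
     xs \<in> Xset P \<and>
     (\<forall>j<nblocks P. \<forall>v. xs[j := v] \<in> Xset P \<longrightarrow>
        aug_lagrangian P lam rho xs \<le> aug_lagrangian P lam rho (xs[j := v]))"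

end

theory Submission
  imports Defs
begin

text \<open>
  The feasible set \<open>\<X>\<close> is a product of finitely many finite sets of binary vectors, and block
  coordinate descent is a descent method on it.

  Finiteness of each \<open>\<X>\<^sub>j\<close> makes every subproblem solvable. For termination, split a sweep from
  \<open>x\<close> to \<open>y\<close> into its hybrid points \<open>(y\<^sub>1; \<dots>; y\<^sub>j; x\<^sub>j\<^sub>+\<^sub>1; \<dots>; x\<^sub>p)\<close>. Since \<open>x\<^sub>j\<close> itself competes in
  the subproblem of block \<open>j\<close>, the augmented Lagrangian never increases from one hybrid point to
  the next; and if a block is only changed when its old value is not a minimizer, every change is
  a strict decrease (\<open>hybrid_descent\<close>). A sweep that moves the iterate hence strictly decreases
  the augmented Lagrangian (\<open>bcd_step_strict_descent\<close>), and a finite set does not admit an infinite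
  strictly decreasing run. At a fixed point of the sweep all hybrid points coincide, so the
  subproblems solved in it are exactly the conditions of blockwise optimality
  (\<open>bcd_fixed_point_blockwise_optimal\<close>).
\<close>

lemma finite_binary_vecs: "finite (binary_vecs k)"
proof (rule finite_subset)
  show "binary_vecs k \<subseteq> vec_of_list ` {xs. set xs \<subseteq> {0, 1} \<and> length xs = k}"
  proof
    fix v assume v: "v \<in> binary_vecs k"
    then have "set (list_of_vec v) \<subseteq> {0, 1} \<and> length (list_of_vec v) = k"
      by (auto simp: binary_vecs_def set_list_of_vec vec_set_def)
    moreover have "v = vec_of_list (list_of_vec v)"
      by (simp add: vec_list)
    ultimately show "v \<in> vec_of_list ` {xs. set xs \<subseteq> {0, 1} \<and> length xs = k}"
      by blast
  qed
  show "finite (vec_of_list ` {xs. set xs \<subseteq> {0, 1::real} \<and> length xs = k})"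
    using finite_lists_length_eq[of "{0, 1::real}" k] by simp
qed

lemma finite_Xblock: "finite (Xblock P j)"
  by (rule finite_subset[OF _ finite_binary_vecs[of "bdim P j"]]) (auto simp: Xblock_def)

lemma finite_Xset: "finite (Xset P)"
proof (rule finite_subset)
  show "Xset P \<subseteq> {xs. set xs \<subseteq> (\<Union>j<nblocks P. Xblock P j) \<and> length xs = nblocks P}"
    by (force simp: Xset_def in_set_conv_nth)
  show "finite {xs. set xs \<subseteq> (\<Union>j<nblocks P. Xblock P j) \<and> length xs = nblocks P}"
    by (rule finite_lists_length_eq) (simp add: finite_Xblock)
qed

lemma block_minimizer_exists:
  assumes "Xset P \<noteq> {}" "length ys < nblocks P"
  shows "\<exists>v. block_minimizer P lam rho x ys v"
proof -
  have "Xblock P (length ys) \<noteq> {}"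
    using assms by (auto simp: Xset_def)
  then show ?thesis
    unfolding block_minimizer_def
    using ex_is_arg_min_if_finite[OF finite_Xblock] by blast
qed

lemma bcd_step_block_minimizer:
  assumes "bcd_step P lam rho x y" "j < nblocks P"
  shows "block_minimizer P lam rho x (take j y) (y ! j)"
  using assms by (simp add: bcd_step_def partial_sweep_def)

lemma bcd_step_Xset:
  assumes "bcd_step P lam rho x y"
  shows "y \<in> Xset P"
proof -
  have "length y = nblocks P"
    using assms by (simp add: bcd_step_def)
  moreover have "y ! j \<in> Xblock P j" if "j < nblocks P" for j
    using bcd_step_block_minimizer[OF assms that] that \<open>length y = nblocks P\<close>
    by (simp add: block_minimizer_def is_arg_min_def)
  ultimately show ?thesis
    by (simp add: Xset_def)
qed

lemma bcd_reachable_Xset: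
  assumes "(bcd_step P lam rho)\<^sup>*\<^sup>* x0 x" "x0 \<in> Xset P"
  shows "x \<in> Xset P"
  using assms by (induction rule: rtranclp_induct) (auto intro: bcd_step_Xset)

text \<open>
  The hybrid points before and after the update of block \<open>j\<close> differ in that block only. Both are
  candidates in its subproblem, and the later one is optimal there. If the two values were equal,
  the old block would be optimal as well, so the convention on ties would have kept it.
\<close>

lemma hybrid_descent:
  assumes step: "bcd_step P lam rho x y" and x: "x \<in> Xset P" and j: "j < nblocks P"
  shows "aug_lagrangian P lam rho (take (Suc j) y @ drop (Suc j) x)
           \<le> aug_lagrangian P lam rho (take j y @ drop j x)"
    and "keeps_minimizers P lam rho x y \<Longrightarrow> y ! j \<noteq> x ! j \<Longrightarrow>
         aug_lagrangian P lam rho (take (Suc j) y @ drop (Suc j) x)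
           < aug_lagrangian P lam rho (take j y @ drop j x)"
proof -
  let ?f = "\<lambda>w. aug_lagrangian P lam rho (take j y @ w # drop (Suc j) x)"
  have len: "length y = nblocks P" "length x = nblocks P"
    using step x by (auto simp: bcd_step_def Xset_def)
  have before: "take j y @ drop j x = take j y @ x ! j # drop (Suc j) x"
    using j len by (simp add: Cons_nth_drop_Suc)
  have after: "take (Suc j) y @ drop (Suc j) x = take j y @ y ! j # drop (Suc j) x"
    using j len by (simp add: take_Suc_conv_app_nth)
  have bm: "block_minimizer P lam rho x (take j y) w \<longleftrightarrow>
      w \<in> Xblock P j \<and> (\<forall>v \<in> Xblock P j. ?f w \<le> ?f v)" for w
    using j len by (auto simp: block_minimizer_def is_arg_min_def not_less)
  have opt: "\<forall>v \<in> Xblock P j. ?f (y ! j) \<le> ?f v"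
    using bcd_step_block_minimizer[OF step j] bm by blast
  have xj: "x ! j \<in> Xblock P j"
    using x j by (simp add: Xset_def)
  show "aug_lagrangian P lam rho (take (Suc j) y @ drop (Suc j) x)
          \<le> aug_lagrangian P lam rho (take j y @ drop j x)"
    unfolding before after using opt xj by blast
  assume "keeps_minimizers P lam rho x y" "y ! j \<noteq> x ! j"
  then have "\<not> block_minimizer P lam rho x (take j y) (x ! j)"
    using j by (auto simp: keeps_minimizers_def)
  then obtain v where "v \<in> Xblock P j" "?f v < ?f (x ! j)"
    using bm xj by (auto simp: not_le)
  then show "aug_lagrangian P lam rho (take (Suc j) y @ drop (Suc j) x)
          < aug_lagrangian P lam rho (take j y @ drop j x)"
    unfolding before after using opt by fastforce
qed

lemma bcd_step_strict_descent:
  assumes step: "bcd_step P lam rho x y" and x: "x \<in> Xset P"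
    and keep: "keeps_minimizers P lam rho x y" and "y \<noteq> x"
  shows "aug_lagrangian P lam rho y < aug_lagrangian P lam rho x"
proof -
  let ?h = "\<lambda>j. aug_lagrangian P lam rho (take j y @ drop j x)"
  let ?p = "nblocks P"
  have len: "length y = ?p" "length x = ?p"
    using step x by (auto simp: bcd_step_def Xset_def)
  have mono: "?h b \<le> ?h a" if "a \<le> b" "b \<le> ?p" for a b
    using that
  proof (induction b rule: dec_induct)
    case (step n)
    then show ?case
      using hybrid_descent(1)[OF assms(1) x, of n] by fastforce
  qed simp
  obtain j where j: "j < ?p" "y ! j \<noteq> x ! j"
    using \<open>y \<noteq> x\<close> len by (metis nth_equalityI)
  have "?h ?p \<le> ?h (Suc j)"
    using mono[of "Suc j" ?p] j by simp
  also have "\<dots> < ?h j"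
    using hybrid_descent(2)[OF step x j(1) keep j(2)] .
  also have "\<dots> \<le> ?h 0"
    using mono[of 0 j] j by simp
  finally show ?thesis
    using len by simp
qed

lemma bcd_fixed_point_blockwise_optimal:
  assumes x: "x \<in> Xset P" and step: "bcd_step P lam rho x x"
  shows "blockwise_optimal P lam rho x"
  unfolding blockwise_optimal_def
proof (intro conjI allI impI x)
  fix j v assume j: "j < nblocks P" and v: "x[j := v] \<in> Xset P"
  have len: "length x = nblocks P"
    using x by (simp add: Xset_def)
  have "v \<in> Xblock P j"
    using v j len by (auto simp: Xset_def)
  then have "aug_lagrangian P lam rho (take j x @ x ! j # drop (Suc j) x)
      \<le> aug_lagrangian P lam rho (take j x @ v # drop (Suc j) x)"
    using bcd_step_block_minimizer[OF step j] j len
    by (auto simp: block_minimizer_def is_arg_min_def not_less)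
  then show "aug_lagrangian P lam rho x \<le> aug_lagrangian P lam rho (x[j := v])"
    using j len by (simp add: upd_conv_take_nth_drop id_take_nth_drop[symmetric])
qed

text \<open>
  A run in which every sweep moves the iterate would have strictly decreasing values,
  hence pairwise distinct iterates in the finite set \<open>\<X>\<close>.
\<close>

lemma bcd_terminates:
  assumes "X 0 \<in> Xset P"
    and step: "\<And>t. bcd_step P lam rho (X t) (X (Suc t))"
    and keep: "\<And>t. keeps_minimizers P lam rho (X t) (X (Suc t))"
  shows "\<exists>T. X (Suc T) = X T"
proof (rule ccontr)
  assume no_stop: "\<nexists>T. X (Suc T) = X T"
  have feasible: "X t \<in> Xset P" for t
    using assms(1) bcd_step_Xset[OF step] by (cases t) auto
  define g where "g t = - aug_lagrangian P lam rho (X t)" for t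
  have "g t < g (Suc t)" for t
    using bcd_step_strict_descent[OF step feasible keep] no_stop by (auto simp: g_def)
  then have "strict_mono g"
    by (simp add: strict_mono_Suc_iff)
  then have "inj X"
    by (metis g_def injI strict_mono_eq)
  moreover have "finite (range X)"
    by (rule finite_subset[OF _ finite_Xset[of P]]) (use feasible in auto)
  ultimately show False
    using finite_imageD by auto
qed

theorem lemma4p1:
  fixes P :: block_problem and lam :: "real vec" and rho :: real and x0 :: "real vec list"
  assumes data: "block_problem_data P"
    and A01: "\<forall>j<nblocks P. \<forall>i<nrows P. \<forall>s<bdim P j. lmat P j $$ (i, s) \<in> {0, 1}"
    and b1: "rhs P = vec (nrows P) (\<lambda>_. 1)"
    and cases:
      "(\<forall>j<nblocks P.
          (\<exists>v\<in>Xblock P j. lmat P j *\<^sub>v v \<le> vec (nrows P) (\<lambda>_. 1)) \<and>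
          cost_support P j \<subseteq> zero_cols P j)
       \<or>
       (\<forall>j<nblocks P.
          card (cost_support P j) \<le> 1 \<and>
          {v \<in> binary_vecs (bdim P j). lmat P j *\<^sub>v v \<le> vec (nrows P) (\<lambda>_. 1)} \<subseteq> Xblock P j)"
    and lam: "lam \<in> carrier_vec (nrows P)" "\<forall>i<nrows P. 0 \<le> lam $ i"
    and rho: "0 < rho"
    and x0: "x0 \<in> Xset P"
  shows
    "\<comment> \<open>executable: every subproblem met along the way has an optimal solution, however ties are broken\<close>
     (\<forall>x ys. (bcd_step P lam rho)\<^sup>*\<^sup>* x0 x \<and> partial_sweep P lam rho x ys \<and> length ys < nblocks P
        \<longrightarrow> (\<exists>v. block_minimizer P lam rho x ys v)) \<and>
     \<comment> \<open>finite termination with a blockwise optimal solution\<close>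
     (\<forall>X. X 0 = x0 \<and>
          (\<forall>t. bcd_step P lam rho (X t) (X (Suc t)) \<and> keeps_minimizers P lam rho (X t) (X (Suc t)))
        \<longrightarrow> (\<exists>T. X (Suc T) = X T \<and> blockwise_optimal P lam rho (X T))) \<and>
     \<comment> \<open>whenever the method stops, however ties are broken, the point is blockwise optimal\<close>
     (\<forall>x. (bcd_step P lam rho)\<^sup>*\<^sup>* x0 x \<and> bcd_step P lam rho x x \<longrightarrow> blockwise_optimal P lam rho x)"
proof (intro conjI allI impI)
  fix x ys
  assume "(bcd_step P lam rho)\<^sup>*\<^sup>* x0 x \<and> partial_sweep P lam rho x ys \<and> length ys < nblocks P"
  then show "\<exists>v. block_minimizer P lam rho x ys v"
    using block_minimizer_exists x0 by blast
next
  fix X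
  assume X: "X 0 = x0 \<and>
    (\<forall>t. bcd_step P lam rho (X t) (X (Suc t)) \<and> keeps_minimizers P lam rho (X t) (X (Suc t)))"
  then obtain T where T: "X (Suc T) = X T"
    using bcd_terminates[of X P lam rho] x0 by auto
  have "bcd_step P lam rho (X T) (X T)"
    using X T by metis
  then have "blockwise_optimal P lam rho (X T)"
    using bcd_fixed_point_blockwise_optimal bcd_step_Xset by blast
  then show "\<exists>T. X (Suc T) = X T \<and> blockwise_optimal P lam rho (X T)"
    using T by blast
next
  fix x
  assume "(bcd_step P lam rho)\<^sup>*\<^sup>* x0 x \<and> bcd_step P lam rho x x"
  then show "blockwise_optimal P lam rho x"
    using bcd_fixed_point_blockwise_optimal bcd_reachable_Xset x0 by blast
qed

end
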